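(* Let $q>0$ and let $(X,d)$ be a complete semimetric space with triangle function $\Phi(u,v)=(u^q+v^q)^{1/q}$. Let $T\colon X\to X$ be a mapping for which there exists $\beta$ with $0\le\beta<2^{-1/q}$ such that $$d(Tx,Ty)\le\beta\max\{d(x,Ty),d(y,Tx)\}\quad\text{for all }x,y\in X.$$ Then $T$ has a unique fixed point.
   Context: A semimetric space $(X,d)$ is a nonempty set $X$ with a function $d\colon X\times X\to[0,\infty)$ such that for all $x,y\in X$: $d(x,y)=0$ if and only if $x=y$, and $d(x,y)=d(y,x)$. That $\Phi(u,v)=(u^q+v^q)^{1/q}$ is a triangle function for $d$ means that $d(x,y)\le\left(d(x,z)^q+d(z,y)^q\right)^{1/q}$ for all $x,y,z\in X$. A sequence $(x_n)$ in $X$ converges to $x\in X$ if $d(x_n,x)\to 0$; it is Cauchy if $d(x_n,x_m)\to 0$ as $n,m\to\infty$; $(X,d)$ is complete if every Cauchy sequence converges to some point of $X$. *)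

theory Defs
  imports Complex_Main "HOL-Library.FuncSet"
begin

definition semimetric_space :: "'a set \<Rightarrow> ('a \<Rightarrow> 'a \<Rightarrow> real) \<Rightarrow> bool" where
  "semimetric_space X d \<longleftrightarrow>
     X \<noteq> {} \<and>
     (\<forall>x\<in>X. \<forall>y\<in>X. 0 \<le> d x y) \<and>
     (\<forall>x\<in>X. \<forall>y\<in>X. d x y = 0 \<longleftrightarrow> x = y) \<and>
     (\<forall>x\<in>X. \<forall>y\<in>X. d x y = d y x)"

definition triangle_function_for ::
    "(real \<Rightarrow> real \<Rightarrow> real) \<Rightarrow> 'a set \<Rightarrow> ('a \<Rightarrow> 'a \<Rightarrow> real) \<Rightarrow> bool" where
  "triangle_function_for \<Phi> X d \<longleftrightarrow>
     (\<forall>x\<in>X. \<forall>y\<in>X. \<forall>z\<in>X. d x y \<le> \<Phi> (d x z) (d z y))"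

definition semimetric_converges ::
    "'a set \<Rightarrow> ('a \<Rightarrow> 'a \<Rightarrow> real) \<Rightarrow> (nat \<Rightarrow> 'a) \<Rightarrow> 'a \<Rightarrow> bool" where
  "semimetric_converges X d s x \<longleftrightarrow> range s \<subseteq> X \<and> x \<in> X \<and> (\<lambda>n. d (s n) x) \<longlonglongrightarrow> 0"

definition semimetric_Cauchy :: "'a set \<Rightarrow> ('a \<Rightarrow> 'a \<Rightarrow> real) \<Rightarrow> (nat \<Rightarrow> 'a) \<Rightarrow> bool" where
  "semimetric_Cauchy X d s \<longleftrightarrow>
     range s \<subseteq> X \<and> (\<forall>\<epsilon>>0. \<exists>N. \<forall>n\<ge>N. \<forall>m\<ge>N. d (s n) (s m) < \<epsilon>)"

definition complete_semimetric_space :: "'a set \<Rightarrow> ('a \<Rightarrow> 'a \<Rightarrow> real) \<Rightarrow> bool" where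
  "complete_semimetric_space X d \<longleftrightarrow>
     semimetric_space X d \<and>
     (\<forall>s. semimetric_Cauchy X d s \<longrightarrow> (\<exists>x\<in>X. semimetric_converges X d s x))"

end

theory Submission
  imports Defs
begin

text \<open>
  Put \<open>\<rho> = d\<^sup>q\<close> (pointwise). Raising the triangle inequality to the \<open>q\<close>-th power makes
  \<open>\<rho>\<close> an ordinary metric, and since \<open>t \<mapsto> t\<^sup>q\<close> is an increasing homeomorphism of
  \<open>[0, \<infinity>)\<close>, the spaces \<open>(X, d)\<close> and \<open>(X, \<rho>)\<close> have the same Cauchy and convergent sequences
  (\<open>complete_semimetric_space_powr\<close>). The map \<open>T\<close> satisfies the same kind of contraction
  condition for \<open>\<rho>\<close>, with constant \<open>b = \<beta>\<^sup>q < 1/2\<close>, so it is enough to treat metrics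
  (\<open>cross_contraction_unique_fixed_point\<close>).

  There the Picard iteration converges: comparing consecutive iterates, one of the two cross
  distances vanishes and the other one spans two steps, so each step is at most \<open>b\<close> times
  the sum of itself and the preceding step, hence at most \<open>b / (1 - b)\<close> times the preceding one.
  This ratio is below \<open>1\<close> exactly because \<open>b < 1/2\<close>. The limit is the fixed point.
\<close>

lemma complete_semimetric_space_powr:
  fixes d :: "'a \<Rightarrow> 'a \<Rightarrow> real"
  assumes complete: "complete_semimetric_space X d" and q: "q > 0"
  shows "complete_semimetric_space X (\<lambda>x y. d x y powr q)"
proof -
  have semi: "semimetric_space X d"
    and lim: "\<And>s. semimetric_Cauchy X d s \<Longrightarrow> \<exists>x\<in>X. semimetric_converges X d s x"
    using complete by (auto simp: complete_semimetric_space_def)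
  have nonneg: "0 \<le> d x y" if "x \<in> X" "y \<in> X" for x y
    using semi that by (auto simp: semimetric_space_def)
  have "semimetric_space X (\<lambda>x y. d x y powr q)"
    using semi q by (auto simp: semimetric_space_def)
  moreover have "\<exists>x\<in>X. semimetric_converges X (\<lambda>x y. d x y powr q) s x"
    if Cauchy: "semimetric_Cauchy X (\<lambda>x y. d x y powr q) s" for s
  proof -
    have range: "range s \<subseteq> X"
      using Cauchy by (simp add: semimetric_Cauchy_def)
    have powr_Cauchy: "\<exists>N. \<forall>n\<ge>N. \<forall>m\<ge>N. d (s n) (s m) powr q < e" if "e > 0" for e
      using Cauchy that by (simp add: semimetric_Cauchy_def)
    have "\<exists>N. \<forall>n\<ge>N. \<forall>m\<ge>N. d (s n) (s m) < \<epsilon>" if \<epsilon>: "\<epsilon> > 0" for \<epsilon>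
    proof -
      obtain N where N: "\<And>n m. n \<ge> N \<Longrightarrow> m \<ge> N \<Longrightarrow> d (s n) (s m) powr q < \<epsilon> powr q"
        using powr_Cauchy[of "\<epsilon> powr q"] \<epsilon> by auto
      have "d (s n) (s m) < \<epsilon>" if "n \<ge> N" "m \<ge> N" for n m
        using N[OF that] \<epsilon> q powr_mono2[of q \<epsilon> "d (s n) (s m)"] by linarith
      then show ?thesis by blast
    qed
    then have "semimetric_Cauchy X d s"
      using range by (simp add: semimetric_Cauchy_def)
    then obtain x where x: "x \<in> X" and conv: "(\<lambda>n. d (s n) x) \<longlonglongrightarrow> 0"
      using lim[of s] by (auto simp: semimetric_converges_def)
    have "0 \<le> d (s n) x" for n
      using nonneg[OF _ x] range by blast
    then have "(\<lambda>n. d (s n) x powr q) \<longlonglongrightarrow> 0"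
      using tendsto_powr'[OF conv tendsto_const[of q]] q by simp
    then show ?thesis
      using x range by (auto simp: semimetric_converges_def)
  qed
  ultimately show ?thesis
    by (simp add: complete_semimetric_space_def)
qed

lemma semimetric_Cauchy_if_geometric_steps:
  fixes \<rho> :: "'a \<Rightarrow> 'a \<Rightarrow> real"
  assumes semi: "semimetric_space X \<rho>"
    and tri: "triangle_function_for (+) X \<rho>"
    and range: "range s \<subseteq> X"
    and steps: "\<And>n. \<rho> (s n) (s (Suc n)) \<le> C * r ^ n"
    and r: "0 \<le> r" "r < 1"
  shows "semimetric_Cauchy X \<rho> s"
proof -
  have X: "s n \<in> X" for n using range by auto
  have sym: "\<rho> (s n) (s m) = \<rho> (s m) (s n)" for n m
    using semi X by (auto simp: semimetric_space_def)
  have nonneg: "0 \<le> \<rho> (s n) (s m)" for n m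
    using semi X by (auto simp: semimetric_space_def)
  have C: "0 \<le> C"
    using order_trans[OF nonneg steps[of 0]] by simp
  \<comment> \<open>The bound is the whole geometric tail from \<open>n\<close> on, so it reproduces itself when the
      first step is split off.\<close>
  have tail: "\<rho> (s n) (s (n + j)) \<le> C * r ^ n / (1 - r)" for n j
  proof (induction j arbitrary: n)
    case 0
    have "\<rho> (s n) (s n) = 0" using semi X by (auto simp: semimetric_space_def)
    then show ?case using C r by simp
  next
    case (Suc j)
    have "\<rho> (s n) (s (n + Suc j)) \<le> \<rho> (s n) (s (Suc n)) + \<rho> (s (Suc n)) (s (Suc n + j))"
      using tri X by (simp add: triangle_function_for_def)
    also have "\<dots> \<le> C * r ^ n + C * r ^ Suc n / (1 - r)"
      using steps Suc.IH by (intro add_mono)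
    also have "\<dots> = C * r ^ n / (1 - r)"
      using r by (simp add: field_simps)
    finally show ?case .
  qed
  have "(\<lambda>n. C * r ^ n / (1 - r)) \<longlonglongrightarrow> C * 0 / (1 - r)"
    using r by (intro tendsto_intros LIMSEQ_realpow_zero) auto
  then have bound_null: "(\<lambda>n. C * r ^ n / (1 - r)) \<longlonglongrightarrow> 0" by simp
  have "\<exists>N. \<forall>n\<ge>N. \<forall>m\<ge>N. \<rho> (s n) (s m) < \<epsilon>" if \<epsilon>: "\<epsilon> > 0" for \<epsilon>
  proof -
    obtain N where N: "\<And>n. n \<ge> N \<Longrightarrow> C * r ^ n / (1 - r) < \<epsilon>"
      using order_tendstoD(2)[OF bound_null \<epsilon>] by (auto simp: eventually_sequentially)
    have *: "\<rho> (s n) (s m) < \<epsilon>" if "n \<ge> N" "n \<le> m" for n m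
      using tail[of n "m - n"] N[of n] that by simp
    have "\<rho> (s n) (s m) < \<epsilon>" if "n \<ge> N" "m \<ge> N" for n m
      using *[of n m] *[of m n] sym[of n m] that by (cases "n \<le> m") auto
    then show ?thesis by blast
  qed
  then show ?thesis
    using range by (simp add: semimetric_Cauchy_def)
qed

text \<open>
  For \<open>y = T x\<close> one of the cross distances is zero and the triangle inequality bounds the other
  by two consecutive steps, so the steps of the Picard iteration decay geometrically. Applied to
  the iterates and their limit \<open>p\<close>, the condition becomes \<open>\<rho> p (T p) \<le> b * \<rho> p (T p)\<close> in the
  limit, which forces \<open>T p = p\<close>; applied to two fixed points, it gives the same
  inequality for their distance.
\<close>

lemma cross_contraction_unique_fixed_point:
  fixes \<rho> :: "'a \<Rightarrow> 'a \<Rightarrow> real"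
  assumes complete: "complete_semimetric_space X \<rho>"
    and tri': "triangle_function_for (+) X \<rho>"
    and T: "T \<in> X \<rightarrow> X"
    and b: "0 \<le> b" "b < 1 / 2"
    and contr: "\<And>x y. x \<in> X \<Longrightarrow> y \<in> X \<Longrightarrow> \<rho> (T x) (T y) \<le> b * max (\<rho> x (T y)) (\<rho> y (T x))"
  shows "\<exists>!x. x \<in> X \<and> T x = x"
proof -
  have semi: "semimetric_space X \<rho>"
    using complete by (simp add: complete_semimetric_space_def)
  have nonneg: "0 \<le> \<rho> x y" and sym: "\<rho> x y = \<rho> y x" and zero: "\<rho> x y = 0 \<longleftrightarrow> x = y"
    if "x \<in> X" "y \<in> X" for x y
    using semi that by (auto simp: semimetric_space_def)
  have tri: "\<rho> x y \<le> \<rho> x z + \<rho> z y" if "x \<in> X" "y \<in> X" "z \<in> X" for x y z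
    using tri' that by (simp add: triangle_function_for_def)
  have TX: "T x \<in> X" if "x \<in> X" for x using T that by auto
  have collapse: "x = y" if "x \<in> X" "y \<in> X" "\<rho> x y \<le> b * \<rho> x y" for x y
  proof -
    have "b * \<rho> x y \<le> 1 / 2 * \<rho> x y"
      using b nonneg that by (intro mult_right_mono) auto
    then show ?thesis using that nonneg[of x y] zero[of x y] by simp
  qed

  obtain x0 where x0: "x0 \<in> X"
    using semi by (auto simp: semimetric_space_def)
  define s where "s n = (T ^^ n) x0" for n
  have s_Suc: "s (Suc n) = T (s n)" for n by (simp add: s_def)
  have sX: "s n \<in> X" for n
    by (induction n) (simp_all add: s_def x0 TX)
  define r where "r = b / (1 - b)"
  have r: "0 \<le> r" "r < 1"
    using b by (auto simp: r_def field_simps)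
  have step: "\<rho> (s (Suc n)) (s (Suc (Suc n))) \<le> r * \<rho> (s n) (s (Suc n))" for n
  proof -
    have "\<rho> (s (Suc n)) (s (Suc n)) = 0" using zero sX by blast
    then have "\<rho> (s (Suc n)) (s (Suc (Suc n))) \<le> b * \<rho> (s n) (s (Suc (Suc n)))"
      using contr[OF sX sX, of n "Suc n"] nonneg[OF sX sX, of n "Suc (Suc n)"]
      by (simp add: s_Suc max_def split: if_splits)
    also have "\<dots> \<le> b * (\<rho> (s n) (s (Suc n)) + \<rho> (s (Suc n)) (s (Suc (Suc n))))"
      using b tri sX by (intro mult_left_mono) auto
    finally show ?thesis using b by (simp add: r_def field_simps)
  qed
  have steps: "\<rho> (s n) (s (Suc n)) \<le> \<rho> (s 0) (s (Suc 0)) * r ^ n" for n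
  proof (induction n)
    case (Suc n)
    have "r * \<rho> (s n) (s (Suc n)) \<le> r * (\<rho> (s 0) (s (Suc 0)) * r ^ n)"
      using Suc r by (intro mult_left_mono) auto
    then show ?case using step[of n] by (simp add: algebra_simps)
  qed simp
  have range: "range s \<subseteq> X" using sX by auto
  have "semimetric_Cauchy X \<rho> s"
    by (rule semimetric_Cauchy_if_geometric_steps[OF semi tri' range steps r])
  then obtain p where p: "p \<in> X" and conv: "(\<lambda>n. \<rho> (s n) p) \<longlonglongrightarrow> 0"
    using complete by (auto simp: complete_semimetric_space_def semimetric_converges_def)
  note Tp = TX[OF p]

  have bound: "\<rho> p (T p) \<le> \<rho> (s (Suc n)) p + b * (\<rho> (s n) p + \<rho> p (T p) + \<rho> (s (Suc n)) p)" for n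
  proof -
    have "\<rho> p (T p) \<le> \<rho> p (s (Suc n)) + \<rho> (s (Suc n)) (T p)"
      using tri p Tp sX by blast
    also have "\<rho> (s (Suc n)) (T p) \<le> b * max (\<rho> (s n) (T p)) (\<rho> p (s (Suc n)))"
      using contr[OF sX p, of n] by (simp add: s_Suc)
    also have "\<dots> \<le> b * (\<rho> (s n) p + \<rho> p (T p) + \<rho> (s (Suc n)) p)"
      using b tri[OF sX Tp p, of n] nonneg[OF sX p, of n] nonneg[OF p Tp]
        nonneg[OF sX p, of "Suc n"] sym[OF p sX, of "Suc n"]
      by (intro mult_left_mono) auto
    finally show ?thesis using sym[OF p sX, of "Suc n"] by simp
  qed
  have "(\<lambda>n. \<rho> (s (Suc n)) p + b * (\<rho> (s n) p + \<rho> p (T p) + \<rho> (s (Suc n)) p))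
          \<longlonglongrightarrow> 0 + b * (0 + \<rho> p (T p) + 0)"
    by (intro tendsto_intros conv LIMSEQ_Suc[OF conv])
  then have "\<rho> p (T p) \<le> 0 + b * (0 + \<rho> p (T p) + 0)"
    using bound by (intro LIMSEQ_le_const) auto
  then have fixed: "T p = p"
    using collapse[OF p Tp] by simp

  show ?thesis
  proof (rule ex1I[of _ p])
    show "p \<in> X \<and> T p = p" using p fixed by simp
    show "x = p" if x: "x \<in> X \<and> T x = x" for x
      using contr[of x p] collapse[of x p] sym[of x p] x p fixed by simp
  qed
qed

theorem corollary2p7:
  fixes X :: "'a set" and d :: "'a \<Rightarrow> 'a \<Rightarrow> real" and T :: "'a \<Rightarrow> 'a" and q :: real
  assumes "q > 0"
    and "complete_semimetric_space X d"
    and "triangle_function_for (\<lambda>u v. (u powr q + v powr q) powr (1 / q)) X d"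
    and "T \<in> X \<rightarrow> X"
    and "\<exists>\<beta>::real. 0 \<le> \<beta> \<and> \<beta> < 2 powr (- 1 / q) \<and>
           (\<forall>x\<in>X. \<forall>y\<in>X. d (T x) (T y) \<le> \<beta> * max (d x (T y)) (d y (T x)))"
  shows "\<exists>!x. x \<in> X \<and> T x = x"
proof -
  define \<rho> where "\<rho> x y = d x y powr q" for x y
  obtain \<beta> where \<beta>: "0 \<le> \<beta>" "\<beta> < 2 powr (- 1 / q)"
    and contr: "\<And>x y. x \<in> X \<Longrightarrow> y \<in> X \<Longrightarrow> d (T x) (T y) \<le> \<beta> * max (d x (T y)) (d y (T x))"
    using assms(5) by blast
  have nonneg: "0 \<le> d x y" if "x \<in> X" "y \<in> X" for x y
    using assms(2) that by (auto simp: complete_semimetric_space_def semimetric_space_def)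
  have TX: "T x \<in> X" if "x \<in> X" for x using assms(4) that by auto
  show ?thesis
  proof (rule cross_contraction_unique_fixed_point)
    show "complete_semimetric_space X \<rho>"
      using complete_semimetric_space_powr[OF assms(2,1)] by (simp add: \<rho>_def[abs_def])
    show "triangle_function_for (+) X \<rho>"
      unfolding triangle_function_for_def
    proof (intro ballI)
      fix x y z assume xyz: "x \<in> X" "y \<in> X" "z \<in> X"
      have "\<rho> x y \<le> ((d x z powr q + d z y powr q) powr (1 / q)) powr q"
        using assms(1,3) nonneg xyz unfolding \<rho>_def
        by (intro powr_mono2) (auto simp: triangle_function_for_def)
      also have "\<dots> = \<rho> x z + \<rho> z y"
        using assms(1) by (simp add: powr_powr \<rho>_def)
      finally show "\<rho> x y \<le> \<rho> x z + \<rho> z y" .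
    qed
    show "T \<in> X \<rightarrow> X" by (rule assms(4))
    show "0 \<le> \<beta> powr q" by simp
    have "\<beta> powr q < (2 powr (- 1 / q)) powr q"
      using \<beta> assms(1) by (intro powr_less_mono2) auto
    also have "\<dots> = 2 powr (- 1)"
      using assms(1) unfolding powr_powr by simp
    also have "\<dots> = 1 / 2"
      by (simp add: powr_minus_divide)
    finally show "\<beta> powr q < 1 / 2" .
    fix x y assume xy: "x \<in> X" "y \<in> X"
    have max_powr: "max u v powr q = max (u powr q) (v powr q)" if "0 \<le> u" "0 \<le> v" for u v :: real
      using that assms(1) powr_mono2[of q u v] powr_mono2[of q v u] by (auto simp: max_def)
    have cross: "0 \<le> d x (T y)" "0 \<le> d y (T x)"
      using nonneg[OF xy(1) TX[OF xy(2)]] nonneg[OF xy(2) TX[OF xy(1)]] by simp_all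
    have "\<rho> (T x) (T y) \<le> (\<beta> * max (d x (T y)) (d y (T x))) powr q"
      unfolding \<rho>_def
      using assms(1) nonneg[OF TX[OF xy(1)] TX[OF xy(2)]] contr[OF xy] by (intro powr_mono2) simp_all
    also have "\<dots> = \<beta> powr q * max (d x (T y)) (d y (T x)) powr q"
      using \<beta> cross by (simp add: powr_mult)
    also have "\<dots> = \<beta> powr q * max (\<rho> x (T y)) (\<rho> y (T x))"
      using max_powr[OF cross] by (simp add: \<rho>_def)
    finally show "\<rho> (T x) (T y) \<le> \<beta> powr q * max (\<rho> x (T y)) (\<rho> y (T x))" .
  qed
qed

end
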